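(* Let $\mathcal F$ be a separable complex Hilbert space with inner product $\langle\cdot,\cdot\rangle$ (linear in the first argument) and norm $\|\cdot\|$, and let $\mathcal K:\mathcal D(\mathcal K)\subseteq\mathcal F\to\mathcal F$ be a densely defined closed linear operator. Let $\ell\ge 1$, and let $(\lambda_i,\phi_i)$, $i=1,\dots,\ell$, be approximate eigenpairs of $\mathcal K$, with $\lambda_i\in\mathbb C$, $\phi_i\in\mathcal D(\mathcal K)$, $\|\phi_i\|=1$. Let $\widetilde\phi_1,\dots,\widetilde\phi_\ell\in\mathcal F$ be such that $\langle\phi_i,\widetilde\phi_j\rangle=\delta_{ij}$ (Kronecker delta) for all $1\le i,j\le\ell$. Put $$\mathsf r_j=\mathcal K\phi_j-\lambda_j\phi_j,\qquad \Delta\mathcal K=\sum_{j=1}^\ell \mathsf r_j\otimes\widetilde\phi_j .$$ Then: (1) $\{\lambda_1,\dots,\lambda_\ell\}\subset\sigma_p(\mathcal K-\Delta\mathcal K)$; (2) the operator norm of each term satisfies $|||\mathsf r_j\otimes\widetilde\phi_j|||=\|\mathsf r_j\|\,\|\widetilde\phi_j\|$, $j=1,\dots,\ell$; (3) the essential spectra of $\mathcal K$ and of $\mathcal K-\Delta\mathcal K$ are identical.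
   Context: For $r,\phi\in\mathcal F$, $r\otimes\phi$ denotes the bounded rank-at-most-one operator $(r\otimes\phi)f=\langle f,\phi\rangle\, r$, $f\in\mathcal F$. $|||\cdot|||$ is the operator norm induced by $\|\cdot\|$. $\sigma_p(A)$ denotes the point spectrum (set of eigenvalues) of $A$. The operator $\mathcal K-\Delta\mathcal K$ has domain $\mathcal D(\mathcal K)$. "Approximate eigenpair" imposes no condition other than those listed (no smallness of $\mathsf r_j$ is assumed). The essential spectrum of a closed operator $A$ is the set of $\zeta\in\mathbb C$ such that $A-\zeta I$ is not a Fredholm operator. *)

theory Defs
  imports "HOL-Analysis.Analysis"
begin

text \<open>Complex Hilbert spaces. The inner product is linear in its first argument; norm, metric,
  topology, real scaling and completeness are those of the superclass \<^class>\<open>banach\<close>, tied to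
  the complex structure by the axioms \<open>scaleR_scaleC\<close> and \<open>norm_eq_sqrt_cinner\<close>.\<close>

class complex_hilbert_space = banach +
  fixes scaleC :: "complex \<Rightarrow> 'a \<Rightarrow> 'a"  (infixr "*\<^sub>C" 75)
    and cinner :: "'a \<Rightarrow> 'a \<Rightarrow> complex"
  assumes scaleC_add_right: "a *\<^sub>C (x + y) = a *\<^sub>C x + a *\<^sub>C y"
    and scaleC_add_left: "(a + b) *\<^sub>C x = a *\<^sub>C x + b *\<^sub>C x"
    and scaleC_scaleC: "a *\<^sub>C b *\<^sub>C x = (a * b) *\<^sub>C x"
    and scaleC_one: "1 *\<^sub>C x = x"
    and scaleR_scaleC: "r *\<^sub>R x = complex_of_real r *\<^sub>C x"
    and cinner_commute: "cinner x y = cnj (cinner y x)"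
    and cinner_add_left: "cinner (x + y) z = cinner x z + cinner y z"
    and cinner_scaleC_left: "cinner (a *\<^sub>C x) y = a * cinner x y"
    and cinner_ge_zero: "0 \<le> Re (cinner x x)"
    and cinner_eq_zero_iff: "cinner x x = 0 \<longleftrightarrow> x = 0"
    and norm_eq_sqrt_cinner: "norm x = sqrt (Re (cinner x x))"

global_interpretation complex_vector:
  vector_space "scaleC :: complex \<Rightarrow> 'a \<Rightarrow> 'a::complex_hilbert_space"
  by unfold_locales (fact scaleC_add_right scaleC_add_left scaleC_scaleC scaleC_one)+

text \<open>A possibly unbounded operator is a pair of a domain \<open>D\<close> and a total function \<open>A\<close>;
  the values of \<open>A\<close> outside \<open>D\<close> are never used.\<close>

definition linear_operator_on ::
    "'a::complex_hilbert_space set \<Rightarrow> ('a \<Rightarrow> 'a) \<Rightarrow> bool" where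
  "linear_operator_on D A \<longleftrightarrow>
     complex_vector.subspace D \<and>
     (\<forall>x\<in>D. \<forall>y\<in>D. A (x + y) = A x + A y) \<and>
     (\<forall>c. \<forall>x\<in>D. A (c *\<^sub>C x) = c *\<^sub>C A x)"

definition closed_operator_on ::
    "'a::complex_hilbert_space set \<Rightarrow> ('a \<Rightarrow> 'a) \<Rightarrow> bool" where
  "closed_operator_on D A \<longleftrightarrow> linear_operator_on D A \<and> closed {(x, A x) | x. x \<in> D}"

definition point_spectrum ::
    "'a::complex_hilbert_space set \<Rightarrow> ('a \<Rightarrow> 'a) \<Rightarrow> complex set" where
  "point_spectrum D A = {z. \<exists>x\<in>D. x \<noteq> 0 \<and> A x = z *\<^sub>C x}"

text \<open>Closed operators with finite-dimensional kernel and closed range of finite codimension.\<close>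

definition fredholm_operator_on ::
    "'a::complex_hilbert_space set \<Rightarrow> ('a \<Rightarrow> 'a) \<Rightarrow> bool" where
  "fredholm_operator_on D A \<longleftrightarrow>
     closed_operator_on D A \<and>
     (\<exists>B. finite B \<and> complex_vector.span B = {x \<in> D. A x = 0}) \<and>
     closed (A ` D) \<and>
     (\<exists>B. finite B \<and> complex_vector.span (A ` D \<union> B) = UNIV)"

definition essential_spectrum ::
    "'a::complex_hilbert_space set \<Rightarrow> ('a \<Rightarrow> 'a) \<Rightarrow> complex set" where
  "essential_spectrum D A = {z. \<not> fredholm_operator_on D (\<lambda>x. A x - z *\<^sub>C x)}"

definition rank_one :: "'a::complex_hilbert_space \<Rightarrow> 'a \<Rightarrow> 'a \<Rightarrow> 'a"  (infix "\<otimes>\<^sub>r" 70) where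
  "(r \<otimes>\<^sub>r \<phi>) f = cinner f \<phi> *\<^sub>C r"

end

theory Submission
  imports Defs
begin

text \<open>
  The correction is built so that \<open>\<Delta>K (\<phi> i) = r i\<close>: biorthogonality kills every other
  summand. Hence \<open>K - \<Delta>K\<close> sends \<open>\<phi> i\<close> to \<open>lam i *\<^sub>C \<phi> i\<close>, and \<open>\<phi> i\<close> is nonzero because it
  has norm one. The norm formula is the Cauchy--Schwarz inequality with equality attained
  at the vector defining the functional (\<open>onorm_rank_one\<close>).

  The essential spectrum is unchanged because a perturbation of finite rank preserves the
  Fredholm property; adding the operators \<open>(- r j) \<otimes>\<^sub>r \<phi>t j\<close> or \<open>r j \<otimes>\<^sub>r \<phi>t j\<close> moves between
  \<open>K - z\<close> and \<open>K - \<Delta>K - z\<close> in either direction. By induction it is enough to add a single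
  rank-one operator \<open>r \<otimes>\<^sub>r \<phi>\<close> to a Fredholm operator \<open>A\<close> with domain \<open>D\<close>
  (\<open>fredholm_add_rank_one\<close>). On \<open>D \<inter> N\<close>, where \<open>N\<close> is the orthogonal complement of \<open>\<phi>\<close>,
  the old and the new operator agree, and \<open>D \<inter> N\<close> has codimension at most one in \<open>D\<close>.
  Therefore the kernel and the range change by at most one dimension, and the graph stays
  closed because \<open>r \<otimes>\<^sub>r \<phi>\<close> is continuous.

  The delicate point is that the new range is closed. It is the image of \<open>D \<inter> N\<close> plus at
  most a line, and a closed subspace plus a line is closed (\<open>closed_subspace_plus_line\<close>).
  That the image of \<open>D \<inter> N\<close> is closed rests on the open mapping theorem: applied to the second
  projection on the graph of \<open>A\<close>, it gives preimages under \<open>A\<close> whose norms are controlled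
  by those of the values. If \<open>N\<close> contains the kernel of \<open>A\<close>, then a limit of values on
  \<open>D \<inter> N\<close> has a preimage that is a limit of points of \<open>D \<inter> N\<close>
  (\<open>closed_operator_image_closed\<close>); otherwise \<open>D \<inter> N\<close> and \<open>D\<close> have the same image.
\<close>

section \<open>Bounded choice of preimages\<close>

text \<open>The Baire category half of the open mapping theorem. The closed image is the union of
  the closures of the images of the balls of integer radius, so one of these closures
  contains a relative ball. Translating it to the origin and scaling shows that every
  value is approximated, with a fixed relative error, by the image of a point of
  proportional norm.\<close>

lemma approximate_preimages:
  fixes P :: "'b::real_normed_vector \<Rightarrow> 'c::banach"
  assumes P: "bounded_linear P" and G: "subspace G" and clR: "closed (P ` G)"
  obtains M where "\<And>y. y \<in> P ` G \<Longrightarrow>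
    \<exists>x\<in>G. norm x \<le> M * norm y \<and> norm (y - P x) \<le> norm y / 2"
proof -
  interpret P: bounded_linear P by (fact P)
  define R where "R = P ` G"
  have subR: "subspace R"
    unfolding R_def by (rule linear_subspace_image[OF P.linear G])
  define T where "T n = closure (P ` (G \<inter> cball 0 (real n)))" for n
  have TR: "T n \<subseteq> R" for n
    unfolding T_def R_def by (rule closure_minimal) (use clR in auto)
  have "R \<subseteq> (\<Union>n. T n)"
  proof
    fix y assume "y \<in> R"
    then obtain x where x: "x \<in> G" "y = P x" by (auto simp: R_def)
    obtain n where "norm x \<le> real n" using real_arch_simple by blast
    then have "y \<in> P ` (G \<inter> cball 0 (real n))" using x by auto
    then have "y \<in> T n" unfolding T_def by (rule subsetD[OF closure_subset])
    then show "y \<in> (\<Union>n. T n)" by blast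
  qed
  with TR have UT: "\<Union>(range T) = R" by blast
  have "\<exists>n. top_of_set R interior_of T n \<noteq> {}"
  proof (rule ccontr)
    assume none: "\<not> ?thesis"
    have cm: "completely_metrizable_space (top_of_set R)"
      using clR completely_metrizable_space_closedin[OF completely_metrizable_space_euclidean]
      by (simp add: R_def)
    have "top_of_set R interior_of \<Union>(range T) = {}"
    proof (rule Baire_category_alt)
      fix X assume "X \<in> range T"
      then obtain n where n: "X = T n" by blast
      have "closedin (top_of_set R) X"
        unfolding n by (rule closed_subset[OF TR]) (simp add: T_def)
      moreover have "top_of_set R interior_of X = {}" using none n by simp
      ultimately show "closedin (top_of_set R) X \<and> top_of_set R interior_of X = {}" by simp
    qed (use cm in auto)
    then have "R = {}"
      unfolding UT using interior_of_topspace[of "top_of_set R"] by simp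
    then show False using subspace_0[OF subR] by blast
  qed
  then obtain n y0 where "y0 \<in> top_of_set R interior_of T n" by blast
  then obtain U where U: "openin (top_of_set R) U" "y0 \<in> U" "U \<subseteq> T n"
    by (auto simp: interior_of_def)
  then obtain e where e: "e > 0" "ball y0 e \<inter> R \<subseteq> U"
    using openin_contains_ball by metis
  have y0R: "y0 \<in> R" using U TR by blast
  \<comment> \<open>Differences of two points of the closure remove the centre of the ball.\<close>
  have near: "\<exists>x\<in>G. norm x \<le> 2 * real n \<and> norm (y - P x) \<le> d"
    if y: "y \<in> R" "norm y < e" and d: "d > 0" for y d
  proof -
    have "y0 + y \<in> ball y0 e \<inter> R"
      using y y0R subspace_add[OF subR] by (auto simp: dist_norm)
    then have "y0 + y \<in> T n" using e U by blast
    then obtain x1 where x1: "x1 \<in> G" "norm x1 \<le> real n" "norm (P x1 - (y0 + y)) < d / 2"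
      unfolding T_def closure_approachable using d
      by (auto simp: dist_norm dest!: spec[of _ "d / 2"])
    have "y0 \<in> T n" using U by blast
    then obtain x2 where x2: "x2 \<in> G" "norm x2 \<le> real n" "norm (P x2 - y0) < d / 2"
      unfolding T_def closure_approachable using d
      by (auto simp: dist_norm dest!: spec[of _ "d / 2"])
    have "x1 - x2 \<in> G" using x1 x2 G by (simp add: subspace_diff)
    moreover have "norm (x1 - x2) \<le> 2 * real n"
      using norm_triangle_ineq4[of x1 x2] x1 x2 by linarith
    moreover have diff: "y - P (x1 - x2) = (P x2 - y0) - (P x1 - (y0 + y))"
      by (simp add: P.diff)
    have "norm (y - P (x1 - x2)) \<le> d"
      unfolding diff using norm_triangle_ineq4[of "P x2 - y0" "P x1 - (y0 + y)"] x1(3) x2(3)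
      by linarith
    ultimately show ?thesis by blast
  qed
  have "\<exists>x\<in>G. norm x \<le> (4 * real n / e) * norm y \<and> norm (y - P x) \<le> norm y / 2"
    if y: "y \<in> P ` G" for y
  proof (cases "y = 0")
    case True
    then show ?thesis using subspace_0[OF G] by (intro bexI[of _ 0]) (auto simp: P.zero)
  next
    case False
    \<comment> \<open>This factor rescales \<open>y\<close> to norm \<open>e / 2\<close>, inside the ball where \<open>near\<close> applies;
      the error \<open>e / 4\<close> then scales back to half the norm of \<open>y\<close>.\<close>
    define c where "c = e / (2 * norm y)"
    have c: "c > 0" using False e by (simp add: c_def)
    have ny: "norm (c *\<^sub>R y) = e / 2" using False e by (simp add: c_def)
    have "c *\<^sub>R y \<in> R" using y subspace_scale[OF subR] by (simp add: R_def)
    then obtain x where x: "x \<in> G" "norm x \<le> 2 * real n" "norm (c *\<^sub>R y - P x) \<le> e / 4"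
      using near[of "c *\<^sub>R y" "e / 4"] ny e by auto
    have "norm (x /\<^sub>R c) \<le> (4 * real n / e) * norm y"
      using mult_left_mono[OF x(2), of "inverse c"] c False e
      by (simp add: c_def field_simps)
    moreover have "y - P (x /\<^sub>R c) = (c *\<^sub>R y - P x) /\<^sub>R c"
      using c by (simp add: P.scaleR scaleR_diff_right)
    then have "norm (y - P (x /\<^sub>R c)) = inverse c * norm (c *\<^sub>R y - P x)"
      using c by simp
    then have "norm (y - P (x /\<^sub>R c)) \<le> inverse c * (e / 4)"
      using mult_left_mono[OF x(3), of "inverse c"] c by simp
    then have "norm (y - P (x /\<^sub>R c)) \<le> norm y / 2"
      using False e by (simp add: c_def field_simps)
    moreover have "x /\<^sub>R c \<in> G" using x G by (simp add: subspace_scale)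
    ultimately show ?thesis by blast
  qed
  then show ?thesis using that by blast
qed

text \<open>The open mapping theorem, obtained by iterating the approximation: completeness turns
  the approximate preimages into an exact one. It is stated for the restriction of a bounded
  operator to a closed subspace so that it applies to the graph of an unbounded operator.\<close>

lemma bounded_preimages:
  fixes P :: "'b::banach \<Rightarrow> 'c::banach"
  assumes P: "bounded_linear P" and G: "subspace G" "closed G" and clR: "closed (P ` G)"
  obtains C where "\<And>y. y \<in> P ` G \<Longrightarrow> \<exists>x\<in>G. P x = y \<and> norm x \<le> C * norm y"
proof -
  interpret P: bounded_linear P by (fact P)
  have subR: "subspace (P ` G)"
    by (rule linear_subspace_image[OF P.linear G(1)])
  obtain M0 where M0: "\<And>y. y \<in> P ` G \<Longrightarrow>
      \<exists>x\<in>G. norm x \<le> M0 * norm y \<and> norm (y - P x) \<le> norm y / 2"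
    using approximate_preimages[OF P G(1) clR] by blast
  \<comment> \<open>If all values are zero, the constant \<open>M0\<close> may be negative.\<close>
  define M where "M = max M0 0"
  have "\<exists>x\<in>G. norm x \<le> M * norm y \<and> norm (y - P x) \<le> norm y / 2" if "y \<in> P ` G" for y
  proof -
    have "M0 * norm y \<le> M * norm y" by (intro mult_right_mono) (auto simp: M_def)
    then show ?thesis using M0[OF that] by (meson order_trans)
  qed
  then obtain h where h: "\<And>y. y \<in> P ` G \<Longrightarrow>
      h y \<in> G \<and> norm (h y) \<le> M * norm y \<and> norm (y - P (h y)) \<le> norm y / 2"
    by metis
  have M: "M \<ge> 0" by (simp add: M_def)
  have "\<exists>x\<in>G. P x = y \<and> norm x \<le> (2 * M) * norm y" if y: "y \<in> P ` G" for y
  proof -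
    \<comment> \<open>Each residue is at most half as large as the one before it, so the corrections
      form a convergent series.\<close>
    define w where "w k = ((\<lambda>v. v - P (h v)) ^^ k) y" for k
    have wSuc: "w (Suc k) = w k - P (h (w k))" for k by (simp add: w_def)
    have w: "w k \<in> P ` G \<and> norm (w k) \<le> norm y * (1/2) ^ k" for k
    proof (induction k)
      case 0
      then show ?case using y by (simp add: w_def)
    next
      case (Suc k)
      have "w (Suc k) \<in> P ` G"
        unfolding wSuc using Suc h subspace_diff[OF subR] by blast
      moreover have "norm (w (Suc k)) \<le> norm (w k) / 2"
        unfolding wSuc using Suc h by blast
      ultimately show ?case using Suc by simp
    qed
    define x where "x k = h (w k)" for k
    have xG: "x k \<in> G" for k using h w by (simp add: x_def)
    have nx: "norm (x k) \<le> (M * norm y) * (1/2) ^ k" for k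
    proof -
      have "norm (x k) \<le> M * norm (w k)" using h w by (simp add: x_def)
      also have "\<dots> \<le> M * (norm y * (1/2) ^ k)" using w M by (intro mult_left_mono) auto
      finally show ?thesis by simp
    qed
    have sums_geo: "(\<lambda>k. (M * norm y) * (1/2) ^ k) sums ((M * norm y) * 2)"
      using sums_mult[OF geometric_sums[of "1/2::real"], of "M * norm y"] by simp
    have summ: "summable x"
      by (rule summable_comparison_test'[OF sums_summable[OF sums_geo]]) (use nx in auto)
    have lim: "(\<lambda>n. \<Sum>k<n. x k) \<longlonglongrightarrow> suminf x"
      using summable_LIMSEQ[OF summ] .
    have "suminf x \<in> G"
      by (rule closed_sequentially[OF G(2) _ lim]) (simp add: xG subspace_sum[OF G(1)])
    moreover have "P (suminf x) = y"
    proof -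
      have part: "P (\<Sum>k<n. x k) = y - w n" for n
        by (induction n) (simp_all add: P.zero P.add w_def x_def)
      have "(\<lambda>n. norm y * (1/2) ^ n) \<longlonglongrightarrow> 0"
        by (intro tendsto_mult_right_zero LIMSEQ_power_zero) simp
      then have "w \<longlonglongrightarrow> 0"
        by (rule Lim_null_comparison[rotated]) (use w in auto)
      then have "(\<lambda>n. y - w n) \<longlonglongrightarrow> y - 0" by (intro tendsto_intros)
      moreover have "(\<lambda>n. y - w n) \<longlonglongrightarrow> P (suminf x)"
        using P.tendsto[OF lim] by (simp add: part)
      ultimately show ?thesis using LIMSEQ_unique by fastforce
    qed
    moreover have "norm (suminf x) \<le> (2 * M) * norm y"
    proof -
      have "norm (suminf x) \<le> (\<Sum>k. (M * norm y) * (1/2) ^ k)"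
        by (rule norm_suminf_le[OF nx sums_summable[OF sums_geo]])
      also have "\<dots> = (M * norm y) * 2" using sums_unique[OF sums_geo] by simp
      finally show ?thesis by simp
    qed
    ultimately show ?thesis by blast
  qed
  then show ?thesis using that by blast
qed

section \<open>Rank-one operators on a complex Hilbert space\<close>

lemma real_subspace_if_complex_subspace:
  assumes "complex_vector.subspace V"
  shows "subspace V"
  using assms
  by (simp add: subspace_def complex_vector.subspace_def scaleR_scaleC)

lemma cinner_zero_left [simp]: "cinner 0 y = 0"
  using cinner_scaleC_left[of 0 0 y] by simp

lemma cinner_zero_right [simp]: "cinner x 0 = 0"
  using cinner_commute[of x 0] by simp

lemma cinner_diff_left: "cinner (x - y) z = cinner x z - cinner y z"
  using cinner_add_left[of "x - y" y z] by simp

lemma cinner_self: "cinner x x = complex_of_real ((norm x)\<^sup>2)"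
proof -
  have "Im (cinner x x) = 0"
    using arg_cong[OF cinner_commute[of x x], of Im] by simp
  then show ?thesis
    by (simp add: complex_eq_iff norm_eq_sqrt_cinner cinner_ge_zero)
qed

lemma norm_scaleC: "norm (c *\<^sub>C x) = cmod c * norm x"
proof -
  have "cinner (c *\<^sub>C x) (c *\<^sub>C x) = c * cnj (c * cinner x x)"
    using cinner_commute[of x "c *\<^sub>C x"] by (simp add: cinner_scaleC_left)
  also have "\<dots> = (c * cnj c) * complex_of_real ((norm x)\<^sup>2)"
    by (simp add: cinner_self)
  also have "\<dots> = complex_of_real ((cmod c * norm x)\<^sup>2)"
    by (simp add: complex_norm_square[symmetric] power_mult_distrib)
  finally have "(norm (c *\<^sub>C x))\<^sup>2 = (cmod c * norm x)\<^sup>2"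
    unfolding cinner_self of_real_eq_iff .
  then show ?thesis by (simp add: power2_eq_iff_nonneg)
qed

lemma norm_cinner_le: "cmod (cinner x y) \<le> norm x * norm y"
proof (cases "y = 0")
  case True
  then show ?thesis by simp
next
  case False
  define a where "a = cinner x y"
  define c where "c = a / cinner y y"
  \<comment> \<open>The difference below is the component of \<open>x\<close> orthogonal to \<open>y\<close>.\<close>
  define p where "p = x - c *\<^sub>C y"
  have yy: "cinner y y \<noteq> 0" using False cinner_eq_zero_iff by blast
  have "cinner p y = 0"
    using yy by (simp add: p_def c_def a_def cinner_diff_left cinner_scaleC_left)
  then have yp: "cinner y p = 0" using cinner_commute[of y p] by simp
  have "cinner p p = cinner x p"
    using cinner_diff_left[of x "c *\<^sub>C y" p] by (simp add: p_def[symmetric] cinner_scaleC_left yp)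
  also have "\<dots> = cnj (cinner x x - c * cinner y x)"
    using cinner_commute[of x p] by (simp add: p_def cinner_diff_left cinner_scaleC_left)
  also have "\<dots> = cinner x x - cnj c * a"
    using cinner_commute[of y x] by (simp add: cinner_self a_def)
  also have "cnj c * a = complex_of_real ((cmod a)\<^sup>2 / (norm y)\<^sup>2)"
    by (simp add: c_def cinner_self complex_norm_square[symmetric] mult.commute)
  finally have "(norm p)\<^sup>2 = (norm x)\<^sup>2 - (cmod a)\<^sup>2 / (norm y)\<^sup>2"
    unfolding cinner_self of_real_diff[symmetric] of_real_eq_iff .
  then have "(cmod a)\<^sup>2 / (norm y)\<^sup>2 \<le> (norm x)\<^sup>2"
    using zero_le_power2[of "norm p"] by linarith
  then have "(cmod a)\<^sup>2 \<le> (norm x * norm y)\<^sup>2"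
    using False by (simp add: field_simps power_mult_distrib)
  then show ?thesis unfolding a_def by (rule power2_le_imp_le) simp
qed

lemma bounded_linear_cinner_left: "bounded_linear (\<lambda>x. cinner x y)"
proof (rule bounded_linear_intro)
  show "cinner (c *\<^sub>R x) y = c *\<^sub>R cinner x y" for c x
    by (simp add: scaleR_scaleC cinner_scaleC_left scaleR_conv_of_real)
qed (auto simp: cinner_add_left intro: norm_cinner_le)

lemma bounded_linear_scaleC_left: "bounded_linear (\<lambda>c. c *\<^sub>C x)"
proof (rule bounded_linear_intro)
  show "(t *\<^sub>R c) *\<^sub>C x = t *\<^sub>R (c *\<^sub>C x)" for t c
    by (simp add: scaleR_scaleC scaleC_scaleC scaleR_conv_of_real)
qed (auto simp: scaleC_add_left norm_scaleC)

lemma bounded_linear_rank_one: "bounded_linear (r \<otimes>\<^sub>r \<phi>)"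
  using bounded_linear_compose[OF bounded_linear_scaleC_left bounded_linear_cinner_left]
  by (simp add: rank_one_def[abs_def])

lemma onorm_rank_one: "onorm (r \<otimes>\<^sub>r \<phi>) = norm r * norm \<phi>"
proof (rule antisym)
  show "onorm (r \<otimes>\<^sub>r \<phi>) \<le> norm r * norm \<phi>"
  proof (rule onorm_bound)
    fix f
    have "cmod (cinner f \<phi>) * norm r \<le> (norm f * norm \<phi>) * norm r"
      by (intro mult_right_mono norm_cinner_le) simp
    then show "norm ((r \<otimes>\<^sub>r \<phi>) f) \<le> norm r * norm \<phi> * norm f"
      by (simp add: rank_one_def norm_scaleC mult_ac)
  qed simp
  show "norm r * norm \<phi> \<le> onorm (r \<otimes>\<^sub>r \<phi>)"
  proof (cases "\<phi> = 0")
    case True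
    then show ?thesis using onorm_pos_le[OF bounded_linear_rank_one] by simp
  next
    case False
    have "norm ((r \<otimes>\<^sub>r \<phi>) \<phi>) \<le> onorm (r \<otimes>\<^sub>r \<phi>) * norm \<phi>"
      by (rule onorm[OF bounded_linear_rank_one])
    moreover have "norm ((r \<otimes>\<^sub>r \<phi>) \<phi>) = (norm r * norm \<phi>) * norm \<phi>"
      by (simp add: rank_one_def norm_scaleC cinner_self norm_power) (simp add: power2_eq_square)
    ultimately show ?thesis using False by simp
  qed
qed

section \<open>Images and kernels of closed operators\<close>

lemma linear_operator_on_diff:
  assumes A: "linear_operator_on D A" and x: "x \<in> D" and y: "y \<in> D"
  shows "A (x - y) = A x - A y"
proof -
  have D: "complex_vector.subspace D" using A by (simp add: linear_operator_on_def)
  have "A ((x - y) + y) = A (x - y) + A y"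
    using A complex_vector.subspace_diff[OF D x y] y unfolding linear_operator_on_def by blast
  then show ?thesis by simp
qed

lemma linear_operator_on_graph_subspace:
  assumes A: "linear_operator_on D A"
  shows "subspace {(x, A x) | x. x \<in> D}"
proof -
  have D: "complex_vector.subspace D" using A by (simp add: linear_operator_on_def)
  have A0: "A 0 = 0"
    using linear_operator_on_diff[OF A, of 0 0] complex_vector.subspace_0[OF D] by simp
  show ?thesis
    using A A0 complex_vector.subspace_0[OF D] complex_vector.subspace_add[OF D]
      complex_vector.subspace_scale[OF D]
    unfolding subspace_def linear_operator_on_def
    by (auto simp: zero_prod_def scaleR_scaleC)
qed

lemma linear_operator_on_image_subspace:
  assumes A: "linear_operator_on D A" and V: "complex_vector.subspace V" "V \<subseteq> D"
  shows "complex_vector.subspace (A ` V)"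
proof (rule complex_vector.subspaceI)
  have add: "A (x + y) = A x + A y" if "x \<in> V" "y \<in> V" for x y
    using A V that unfolding linear_operator_on_def by blast
  have scale: "A (c *\<^sub>C x) = c *\<^sub>C A x" if "x \<in> V" for c x
    using A V that unfolding linear_operator_on_def by blast
  have "A 0 = 0" using scale[OF complex_vector.subspace_0[OF V(1)], of 0] by simp
  then show "0 \<in> A ` V" using complex_vector.subspace_0[OF V(1)] by (metis imageI)
  show "x + y \<in> A ` V" if "x \<in> A ` V" "y \<in> A ` V" for x y
    using that add complex_vector.subspace_add[OF V(1)] by (force simp: image_iff)
  show "c *\<^sub>C x \<in> A ` V" if "x \<in> A ` V" for c x
    using that scale complex_vector.subspace_scale[OF V(1)] by (metis (no_types) image_iff)
qed

text \<open>If values \<open>A (xs n)\<close> with \<open>xs n \<in> N\<close> converge to \<open>A x\<close>, the points \<open>xs n\<close>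
  need not converge. Small preimages of the differences \<open>A (xs n) - A x\<close> provide other
  preimages of the same values that do converge to \<open>x\<close>; the kernel condition keeps them
  in \<open>N\<close>. Without it, closedness can fail, since \<open>A ` (D \<inter> N)\<close> is the image of
  \<open>D \<inter> (N + ker A)\<close> and a sum of closed subspaces need not be closed.\<close>

lemma closed_operator_image_closed:
  assumes A: "closed_operator_on D A" and clR: "closed (A ` D)"
    and N: "subspace N" "closed N" and ker: "{x \<in> D. A x = 0} \<subseteq> N"
  shows "closed (A ` (D \<inter> N))"
proof -
  define G where "G = {(x, A x) | x. x \<in> D}"
  have lin: "linear_operator_on D A" and clG: "closed G"
    using A by (auto simp: closed_operator_on_def G_def)
  have subG: "subspace G"
    unfolding G_def by (rule linear_operator_on_graph_subspace[OF lin])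
  have D: "complex_vector.subspace D" using lin by (simp add: linear_operator_on_def)
  have img: "snd ` G = A ` D" by (force simp: G_def)
  obtain C where C: "\<And>y. y \<in> snd ` G \<Longrightarrow> \<exists>g\<in>G. snd g = y \<and> norm g \<le> C * norm y"
    using bounded_preimages[OF bounded_linear_snd subG clG] clR img by metis
  have pre: "\<exists>w\<in>D. A w = y \<and> norm w \<le> C * norm y" if y: "y \<in> A ` D" for y
  proof -
    obtain g where g: "g \<in> G" "snd g = y" "norm g \<le> C * norm y" using C y img by metis
    moreover have "norm (fst g) \<le> norm g" using norm_fst_le[of "fst g" "snd g"] by simp
    ultimately show ?thesis by (force simp: G_def)
  qed
  show ?thesis
    unfolding closed_sequential_limits
  proof (intro allI impI, elim conjE)
    fix ys y assume ys: "\<forall>n. ys n \<in> A ` (D \<inter> N)" and lim: "ys \<longlonglongrightarrow> y"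
    have "\<forall>n. \<exists>x. x \<in> D \<inter> N \<and> ys n = A x" using ys by blast
    then obtain xs where xs: "\<And>n. xs n \<in> D \<inter> N" "\<And>n. ys n = A (xs n)" by metis
    have "y \<in> A ` D" by (rule closed_sequentially[OF clR _ lim]) (use xs in auto)
    then obtain x where x: "x \<in> D" "y = A x" by blast
    have "ys n - y \<in> A ` D" for n
      using xs x linear_operator_on_diff[OF lin] complex_vector.subspace_diff[OF D]
      by (metis IntD1 imageI)
    then have "\<forall>n. \<exists>w. w \<in> D \<and> A w = ys n - y \<and> norm w \<le> C * norm (ys n - y)"
      using pre by blast
    then obtain w where w: "\<And>n. w n \<in> D" "\<And>n. A (w n) = ys n - y"
        "\<And>n. norm (w n) \<le> C * norm (ys n - y)" by metis
    \<comment> \<open>The preimages \<open>x + w n\<close> differ from \<open>xs n\<close> by kernel elements, so they lie in \<open>N\<close>.\<close>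
    have xwN: "x + w n \<in> N" for n
    proof -
      have "A (x + w n) = ys n"
        using lin x w unfolding linear_operator_on_def by simp
      moreover have "x + w n \<in> D" using x w complex_vector.subspace_add[OF D] by blast
      ultimately have "x + w n - xs n \<in> {x \<in> D. A x = 0}"
        using xs linear_operator_on_diff[OF lin] complex_vector.subspace_diff[OF D] by simp
      then have "x + w n - xs n \<in> N" using ker by blast
      then show ?thesis using subspace_add[OF N(1), of "x + w n - xs n" "xs n"] xs by simp
    qed
    have "(\<lambda>n. C * norm (ys n - y)) \<longlonglongrightarrow> 0"
      using lim by (intro tendsto_mult_right_zero) (simp add: tendsto_norm_zero LIM_zero)
    then have "w \<longlonglongrightarrow> 0"
      by (rule Lim_null_comparison[rotated]) (use w in auto)
    then have "(\<lambda>n. x + w n) \<longlonglongrightarrow> x + 0" by (intro tendsto_intros)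
    then have "x \<in> N" using closed_sequentially[OF N(2)] xwN by fastforce
    then show "y \<in> A ` (D \<inter> N)" using x by blast
  qed
qed

text \<open>A vector \<open>w\<close> outside \<open>S\<close> has positive distance from \<open>S\<close>. This bounds the coefficient of
  \<open>w\<close> by the norm of the sum, so that along a convergent sequence of sums the coefficients
  converge, and with them the components in \<open>S\<close>.\<close>

lemma closed_subspace_plus_line:
  assumes S: "complex_vector.subspace S" "closed S"
  shows "closed {s + c *\<^sub>C w | s c. s \<in> S}" (is "closed ?T")
proof (cases "w \<in> S")
  case True
  have "?T = S"
  proof
    show "?T \<subseteq> S"
      using True complex_vector.subspace_add[OF S(1)] complex_vector.subspace_scale[OF S(1)] by blast
    show "S \<subseteq> ?T" by (force intro: exI[of _ 0])
  qed
  then show ?thesis using S by simp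
next
  case False
  then obtain d where d: "d > 0" "\<And>s. s \<in> S \<Longrightarrow> d \<le> norm (w - s)"
    using S(2) by (metis closed_approachable dist_norm dist_commute not_less)
  have lower: "cmod c * d \<le> norm (s + c *\<^sub>C w)" if s: "s \<in> S" for s c
  proof (cases "c = 0")
    case False
    have "d \<le> norm (w - (- (inverse c)) *\<^sub>C s)"
      by (intro d complex_vector.subspace_scale[OF S(1)] s)
    then have "cmod c * d \<le> norm (c *\<^sub>C (w - (- (inverse c)) *\<^sub>C s))"
      by (simp add: norm_scaleC mult_left_mono)
    also have "c *\<^sub>C (w - (- (inverse c)) *\<^sub>C s) = s + c *\<^sub>C w"
      using False by (simp add: complex_vector.scale_right_diff_distrib scaleC_scaleC scaleC_one
        scaleC_add_right add.commute)
    finally show ?thesis .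
  qed simp
  show ?thesis
    unfolding closed_sequential_limits
  proof (intro allI impI, elim conjE)
    fix ys y assume ys: "\<forall>n. ys n \<in> ?T" and lim: "ys \<longlonglongrightarrow> y"
    have "\<forall>n. \<exists>s c. s \<in> S \<and> ys n = s + c *\<^sub>C w" using ys by blast
    then obtain s c where sc: "\<And>n. s n \<in> S" "\<And>n. ys n = s n + c n *\<^sub>C w" by metis
    have bd: "cmod (c m - c n) * d \<le> norm (ys m - ys n)" for m n
    proof -
      have "ys m - ys n = (s m - s n) + (c m - c n) *\<^sub>C w"
        by (simp add: sc complex_vector.scale_left_diff_distrib)
      then show ?thesis
        using lower[OF complex_vector.subspace_diff[OF S(1) sc(1) sc(1)]] by simp
    qed
    have "Cauchy c"
    proof (rule CauchyI)
      fix e :: real assume "e > 0"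
      then have "e * d > 0" using d by simp
      then obtain k where "\<forall>m\<ge>k. \<forall>n\<ge>k. norm (ys m - ys n) < e * d"
        using CauchyD[OF LIMSEQ_imp_Cauchy[OF lim]] by blast
      then have "\<forall>m\<ge>k. \<forall>n\<ge>k. cmod (c m - c n) * d < e * d"
        using bd le_less_trans by blast
      then show "\<exists>k. \<forall>m\<ge>k. \<forall>n\<ge>k. cmod (c m - c n) < e" using d by auto
    qed
    then obtain c0 where c0: "c \<longlonglongrightarrow> c0"
      using Cauchy_convergent convergent_def by blast
    have "(\<lambda>n. ys n - c n *\<^sub>C w) \<longlonglongrightarrow> y - c0 *\<^sub>C w"
      by (intro tendsto_diff lim bounded_linear.tendsto[OF bounded_linear_scaleC_left] c0)
    moreover have "ys n - c n *\<^sub>C w = s n" for n by (simp add: sc)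
    ultimately have "s \<longlonglongrightarrow> y - c0 *\<^sub>C w" by simp
    then have "y - c0 *\<^sub>C w \<in> S" using closed_sequentially[OF S(2)] sc by blast
    then show "y \<in> ?T" by (auto intro!: exI[of _ "y - c0 *\<^sub>C w"] exI[of _ c0])
  qed
qed

lemma subspace_of_finite_span:
  assumes V: "complex_vector.subspace V" and "finite B" and "V \<subseteq> complex_vector.span B"
  shows "\<exists>B'. finite B' \<and> complex_vector.span B' = V"
proof -
  obtain B' where B': "B' \<subseteq> V" "complex_vector.independent B'" "V \<subseteq> complex_vector.span B'"
    using complex_vector.maximal_independent_subset by blast
  have "finite B'"
    using complex_vector.independent_span_bound[OF \<open>finite B\<close> B'(2)] B' assms by blast
  moreover have "complex_vector.span B' = V"
    using complex_vector.span_minimal[OF B'(1) V] B' by blast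
  ultimately show ?thesis by blast
qed

lemma linear_operator_on_kernel_subspace:
  assumes A: "linear_operator_on D A"
  shows "complex_vector.subspace {x \<in> D. A x = 0}"
proof -
  have D: "complex_vector.subspace D" using A by (simp add: linear_operator_on_def)
  have "A 0 = 0"
    using linear_operator_on_diff[OF A, of 0 0] complex_vector.subspace_0[OF D] by simp
  then show ?thesis
    using A complex_vector.subspace_0[OF D] complex_vector.subspace_add[OF D]
      complex_vector.subspace_scale[OF D]
    unfolding linear_operator_on_def by (intro complex_vector.subspaceI) auto
qed

section \<open>Finite-rank perturbations of Fredholm operators\<close>

text \<open>The new graph is the preimage of the old one under a continuous shear.\<close>

lemma closed_operator_on_add_rank_one:
  assumes A: "closed_operator_on D A"
  shows "closed_operator_on D (\<lambda>x. A x + (r \<otimes>\<^sub>r \<phi>) x)"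
proof -
  have lin: "linear_operator_on D A" and clG: "closed {(x, A x) | x. x \<in> D}"
    using A by (auto simp: closed_operator_on_def)
  have "linear_operator_on D (\<lambda>x. A x + (r \<otimes>\<^sub>r \<phi>) x)"
    using lin by (simp add: linear_operator_on_def rank_one_def cinner_add_left
      cinner_scaleC_left scaleC_add_left scaleC_add_right scaleC_scaleC)
  moreover have "{(x, A x + (r \<otimes>\<^sub>r \<phi>) x) | x. x \<in> D}
      = (\<lambda>p. (fst p, snd p - (r \<otimes>\<^sub>r \<phi>) (fst p))) -` {(x, A x) | x. x \<in> D}"
    by (auto simp: algebra_simps)
  moreover have "closed \<dots>"
    by (intro closed_vimage[OF clG] continuous_intros
      bounded_linear.continuous_on[OF bounded_linear_rank_one])
  ultimately show ?thesis by (simp add: closed_operator_on_def)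
qed

text \<open>Both operators restrict to the same operator on the kernel \<open>N\<close> of \<open>\<lambda>x. cinner x \<phi>\<close>.
  A subspace not contained in \<open>N\<close> is its intersection with \<open>N\<close> plus a line; this
  is applied to the new kernel and to the domain.\<close>

lemma fredholm_add_rank_one:
  assumes fred: "fredholm_operator_on D A"
  shows "fredholm_operator_on D (\<lambda>x. A x + (r \<otimes>\<^sub>r \<phi>) x)"
proof -
  define A' where "A' = (\<lambda>x. A x + (r \<otimes>\<^sub>r \<phi>) x)"
  define N where "N = {x. cinner x \<phi> = 0}"
  have clA: "closed_operator_on D A" and clR: "closed (A ` D)"
    using fred by (auto simp: fredholm_operator_on_def)
  have lin: "linear_operator_on D A" using clA by (simp add: closed_operator_on_def)
  have D: "complex_vector.subspace D" using lin by (simp add: linear_operator_on_def)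
  have clA': "closed_operator_on D A'"
    unfolding A'_def by (rule closed_operator_on_add_rank_one[OF clA])
  have lin': "linear_operator_on D A'" using clA' by (simp add: closed_operator_on_def)
  have csubN: "complex_vector.subspace N"
    by (auto simp: complex_vector.subspace_def N_def cinner_add_left cinner_scaleC_left)
  have clN: "closed N"
    unfolding N_def
    by (intro closed_Collect_eq bounded_linear.continuous_on[OF bounded_linear_cinner_left]
        continuous_intros)
  have eqN: "A' x = A x" if "x \<in> N" for x
    using that by (simp add: A'_def N_def rank_one_def)
  \<comment> \<open>A vector of \<open>V\<close> outside \<open>N\<close>, scaled to \<open>cinner v \<phi> = 1\<close>, splits \<open>V\<close> as
    the sum of \<open>V \<inter> N\<close> and a line.\<close>
  have split: "\<exists>v\<in>V. \<forall>x\<in>V. x - cinner x \<phi> *\<^sub>C v \<in> V \<inter> N"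
    if V: "complex_vector.subspace V" "\<not> V \<subseteq> N" for V
  proof -
    obtain u where u: "u \<in> V" "cinner u \<phi> \<noteq> 0" using V by (auto simp: N_def)
    define v where "v = inverse (cinner u \<phi>) *\<^sub>C u"
    have v: "v \<in> V" "cinner v \<phi> = 1"
      using u V by (auto simp: v_def cinner_scaleC_left complex_vector.subspace_scale)
    then have "x - cinner x \<phi> *\<^sub>C v \<in> V \<inter> N" if "x \<in> V" for x
      using that V by (auto simp: N_def cinner_diff_left cinner_scaleC_left
        complex_vector.subspace_diff complex_vector.subspace_scale)
    then show ?thesis using v by blast
  qed
  have kernel: "\<exists>B. finite B \<and> complex_vector.span B = {x \<in> D. A' x = 0}"
  proof -
    define V where "V = {x \<in> D. A' x = 0}"
    have V: "complex_vector.subspace V"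
      unfolding V_def by (rule linear_operator_on_kernel_subspace[OF lin'])
    obtain B where B: "finite B" "complex_vector.span B = {x \<in> D. A x = 0}"
      using fred by (auto simp: fredholm_operator_on_def)
    have VN: "V \<inter> N \<subseteq> complex_vector.span B"
      unfolding B(2) using eqN by (auto simp: V_def)
    show ?thesis
    proof (cases "V \<subseteq> N")
      case True
      then show ?thesis using subspace_of_finite_span[OF V B(1)] VN by (auto simp: V_def)
    next
      case False
      then obtain v where v: "v \<in> V" "\<forall>x\<in>V. x - cinner x \<phi> *\<^sub>C v \<in> V \<inter> N"
        using split[OF V] by blast
      have "V \<subseteq> complex_vector.span (insert v B)"
        using v(2) VN by (auto simp: complex_vector.span_insert)
      then show ?thesis using subspace_of_finite_span[OF V, of "insert v B"] B(1) by (simp add: V_def)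
    qed
  qed
  have clS: "closed (A ` (D \<inter> N))"
  proof (cases "{x \<in> D. A x = 0} \<subseteq> N")
    case True
    show ?thesis
      by (rule closed_operator_image_closed[OF clA clR
            real_subspace_if_complex_subspace[OF csubN] clN True])
  next
    case False
    \<comment> \<open>A kernel element outside \<open>N\<close> can be used to move any vector of \<open>D\<close> into \<open>N\<close>
      without changing its image.\<close>
    then obtain v where v: "v \<in> {x \<in> D. A x = 0}" "cinner v \<phi> \<noteq> 0" by (auto simp: N_def)
    have "A ` D \<subseteq> A ` (D \<inter> N)"
    proof
      fix y assume "y \<in> A ` D"
      then obtain x where x: "x \<in> D" "y = A x" by blast
      define c where "c = cinner x \<phi> / cinner v \<phi>"
      have cv: "c *\<^sub>C v \<in> {x \<in> D. A x = 0}"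
        using complex_vector.subspace_scale[OF linear_operator_on_kernel_subspace[OF lin] v(1)] .
      have "x - c *\<^sub>C v \<in> D \<inter> N"
        using x cv v complex_vector.subspace_diff[OF D]
        by (auto simp: N_def c_def cinner_diff_left cinner_scaleC_left)
      moreover have "A (x - c *\<^sub>C v) = y"
        using linear_operator_on_diff[OF lin] x cv by simp
      ultimately show "y \<in> A ` (D \<inter> N)" by blast
    qed
    then have "A ` (D \<inter> N) = A ` D" by blast
    then show ?thesis using clR by simp
  qed
  have range: "closed (A' ` D)"
  proof (cases "D \<subseteq> N")
    case True
    then have "A' ` D = A ` (D \<inter> N)" using eqN by (intro image_cong) auto
    then show ?thesis using clS by simp
  next
    case False
    then obtain u where u: "u \<in> D" "\<forall>x\<in>D. x - cinner x \<phi> *\<^sub>C u \<in> D \<inter> N"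
      using split[OF D] by blast
    have subDN: "complex_vector.subspace (D \<inter> N)"
      by (rule complex_vector.subspace_inter[OF D csubN])
    have comb: "A' (x + c *\<^sub>C u) = A' x + c *\<^sub>C A' u" if "x \<in> D" for x c
      using lin' u(1) that complex_vector.subspace_scale[OF D u(1)]
      unfolding linear_operator_on_def by simp
    have "A' ` D = {s + c *\<^sub>C A' u | s c. s \<in> A ` (D \<inter> N)}" (is "_ = ?T")
    proof
      show "A' ` D \<subseteq> ?T"
      proof
        fix y assume "y \<in> A' ` D"
        then obtain x where x: "x \<in> D" "y = A' x" by blast
        define z where "z = x - cinner x \<phi> *\<^sub>C u"
        have z: "z \<in> D \<inter> N" using u x by (simp add: z_def)
        have "y = A z + cinner x \<phi> *\<^sub>C A' u"
          using comb[of z "cinner x \<phi>"] z x eqN by (simp add: z_def)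
        then show "y \<in> ?T" using z by blast
      qed
      show "?T \<subseteq> A' ` D"
      proof
        fix y assume "y \<in> ?T"
        then obtain z c where z: "z \<in> D \<inter> N" "y = A z + c *\<^sub>C A' u" by blast
        then have "y = A' (z + c *\<^sub>C u)" using comb eqN by simp
        moreover have "z + c *\<^sub>C u \<in> D"
          using z u D by (simp add: complex_vector.subspace_add complex_vector.subspace_scale)
        ultimately show "y \<in> A' ` D" by blast
      qed
    qed
    moreover have "complex_vector.subspace (A ` (D \<inter> N))"
      by (rule linear_operator_on_image_subspace[OF lin subDN]) blast
    ultimately show ?thesis using closed_subspace_plus_line clS by simp
  qed
  \<comment> \<open>The old range lies in the new range plus the line through \<open>r\<close>.\<close>
  have corange: "\<exists>B. finite B \<and> complex_vector.span (A' ` D \<union> B) = UNIV"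
  proof -
    obtain B where B: "finite B" "complex_vector.span (A ` D \<union> B) = UNIV"
      using fred by (auto simp: fredholm_operator_on_def)
    let ?W = "complex_vector.span (A' ` D \<union> insert r B)"
    have "A x \<in> ?W" if "x \<in> D" for x
    proof -
      have "A' x - cinner x \<phi> *\<^sub>C r \<in> ?W"
        using that by (intro complex_vector.span_diff complex_vector.span_scale
          complex_vector.span_base) auto
      then show ?thesis by (simp add: A'_def rank_one_def)
    qed
    then have "A ` D \<subseteq> ?W" by (rule image_subsetI)
    moreover have "B \<subseteq> ?W"
      by (rule subset_trans[OF _ complex_vector.span_superset]) auto
    ultimately have "A ` D \<union> B \<subseteq> ?W" by (rule Un_least)
    then have "complex_vector.span (A ` D \<union> B) \<subseteq> ?W"
      by (rule complex_vector.span_minimal) (rule complex_vector.subspace_span)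
    then have "?W = UNIV" unfolding B(2) by (rule top.extremum_uniqueI)
    then show ?thesis using B(1) by (intro exI[of _ "insert r B"]) simp
  qed
  show ?thesis
    using clA' kernel range corange unfolding fredholm_operator_on_def A'_def by simp
qed

lemma fredholm_add_sum_rank_one:
  assumes "fredholm_operator_on D A" and "finite J"
  shows "fredholm_operator_on D (\<lambda>x. A x + (\<Sum>j\<in>J. (r j \<otimes>\<^sub>r \<phi> j) x))"
  using assms(2)
proof (induction J rule: finite_induct)
  case empty
  then show ?case using assms(1) by simp
next
  case (insert i J)
  then show ?case
    using fredholm_add_rank_one[OF insert.IH, of "r i" "\<phi> i"] by (simp add: add_ac)
qed

lemma rank_one_uminus: "(- r \<otimes>\<^sub>r \<phi>) x = - (r \<otimes>\<^sub>r \<phi>) x"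
  by (simp add: rank_one_def)

text \<open>The perturbation can be undone by another one of the same form, so one direction of
  Fredholm stability gives both inclusions.\<close>

lemma essential_spectrum_diff_sum_rank_one:
  assumes "finite J"
  shows "essential_spectrum D (\<lambda>x. K x - (\<Sum>j\<in>J. (r j \<otimes>\<^sub>r \<phi> j) x)) = essential_spectrum D K"
proof -
  have "fredholm_operator_on D (\<lambda>x. K x - (\<Sum>j\<in>J. (r j \<otimes>\<^sub>r \<phi> j) x) - z *\<^sub>C x)
      \<longleftrightarrow> fredholm_operator_on D (\<lambda>x. K x - z *\<^sub>C x)" (is "?L \<longleftrightarrow> ?R") for z
  proof
    assume ?L
    from fredholm_add_sum_rank_one[OF this assms, of r \<phi>] show ?R
      by (simp add: algebra_simps)
  next
    assume ?R
    from fredholm_add_sum_rank_one[OF this assms, of "\<lambda>j. - r j" \<phi>] show ?L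
      by (simp add: rank_one_uminus sum_negf algebra_simps)
  qed
  then show ?thesis by (simp add: essential_spectrum_def)
qed

section \<open>Correcting an operator so that approximate eigenpairs become exact\<close>

theorem theorem3p1:
  fixes D :: "'a::complex_hilbert_space set"
    and K \<Delta>K :: "'a \<Rightarrow> 'a"
    and l :: nat
    and lam :: "nat \<Rightarrow> complex"
    and \<phi> \<phi>t r :: "nat \<Rightarrow> 'a"
  assumes "separable_space (euclidean :: 'a topology)"
    and "closure D = UNIV"
    and "closed_operator_on D K"
    and "l \<ge> 1"
    and "\<And>i. i \<in> {1..l} \<Longrightarrow> \<phi> i \<in> D"
    and "\<And>i. i \<in> {1..l} \<Longrightarrow> norm (\<phi> i) = 1"
    and "\<And>i j. i \<in> {1..l} \<Longrightarrow> j \<in> {1..l} \<Longrightarrow> cinner (\<phi> i) (\<phi>t j) = (if i = j then 1 else 0)"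
    and "\<And>j. j \<in> {1..l} \<Longrightarrow> r j = K (\<phi> j) - lam j *\<^sub>C \<phi> j"
    and "\<And>f. \<Delta>K f = (\<Sum>j=1..l. (r j \<otimes>\<^sub>r \<phi>t j) f)"
  shows "lam ` {1..l} \<subseteq> point_spectrum D (\<lambda>f. K f - \<Delta>K f)
    \<and> (\<forall>j\<in>{1..l}. onorm (r j \<otimes>\<^sub>r \<phi>t j) = norm (r j) * norm (\<phi>t j))
    \<and> essential_spectrum D K = essential_spectrum D (\<lambda>f. K f - \<Delta>K f)"
proof (intro conjI)
  show "lam ` {1..l} \<subseteq> point_spectrum D (\<lambda>f. K f - \<Delta>K f)"
  proof
    fix z assume "z \<in> lam ` {1..l}"
    then obtain i where i: "i \<in> {1..l}" "z = lam i" by blast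
    have "\<Delta>K (\<phi> i) = (\<Sum>j=1..l. if i = j then r j else 0)"
      unfolding assms(9) rank_one_def
      by (intro sum.cong) (auto simp: assms(7)[OF i(1)] scaleC_one)
    also have "\<dots> = r i" using i by simp
    finally have "K (\<phi> i) - \<Delta>K (\<phi> i) = z *\<^sub>C \<phi> i" using assms(8) i by simp
    moreover have "\<phi> i \<noteq> 0" using assms(6)[OF i(1)] by auto
    ultimately show "z \<in> point_spectrum D (\<lambda>f. K f - \<Delta>K f)"
      using assms(5) i unfolding point_spectrum_def by blast
  qed
  show "\<forall>j\<in>{1..l}. onorm (r j \<otimes>\<^sub>r \<phi>t j) = norm (r j) * norm (\<phi>t j)"
    by (simp add: onorm_rank_one)
  show "essential_spectrum D K = essential_spectrum D (\<lambda>f. K f - \<Delta>K f)"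
    unfolding assms(9) by (simp add: essential_spectrum_diff_sum_rank_one)
qed

end
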